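(* For every fixed $k,d\in\mathbb{N}$ with $1\leq k\leq d$, the number of $k$-dimensional simplices of minimum (nonzero) volume spanned by $n$ points in $\mathbb{R}^d$ is $O(n^k)$, and there are $n$-element point sets in $\mathbb{R}^d$ for which this number is $\Omega(n^k)$.
   Context: A $k$-dimensional simplex spanned by a finite set $S\subset\mathbb{R}^d$ is determined by $k+1$ affinely independent points of $S$ (its vertices), and its volume is its $k$-dimensional volume. It has minimum (nonzero) volume if its volume equals the minimum of the (positive) $k$-dimensional volumes of all $k$-dimensional simplices spanned by $S$. The constants hidden in $O(\cdot)$ and $\Omega(\cdot)$ depend only on $k$ and $d$. *)

theory Defs
  imports "HOL-Analysis.Analysis"
begin

text \<open>
  The dimensions \<open>k\<close> and \<open>d\<close> are the cardinalities of the index types \<^typ>\<open>'k\<close> and \<^typ>\<open>'d\<close>;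
  as \<^typ>\<open>'k\<close> does not occur in the types of the point sets, it is passed as an explicit type
  argument.
\<close>

text \<open>
  The \<open>k\<close>-dimensional volume of a subset of a \<open>k\<close>-flat in \<open>\<real>\<^sup>d\<close>: its Lebesgue measure after an
  isometric identification of \<open>\<real>\<^sup>k\<close> with a flat containing it. Since Lebesgue measure is invariant
  under isometries, the value does not depend on the chosen identification. A suitable
  identification exists whenever \<open>k \<le> d\<close> and \<open>A\<close> lies in the affine hull of at most \<open>k + 1\<close> points;
  for other sets the value is unspecified.
\<close>

definition flat_volume :: "'k::finite itself \<Rightarrow> (real ^ 'd::finite) set \<Rightarrow> real" where
  "flat_volume TYPE('k) A =
     (let f = (SOME f :: real ^ 'k \<Rightarrow> real ^ 'd.
                 (\<forall>x y. dist (f x) (f y) = dist x y) \<and> A \<subseteq> range f)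
      in measure lebesgue (f -` A))"

text \<open>
  A simplex is represented by its vertex set; affinely independent sets are determined by their
  convex hulls, so counting vertex sets is counting simplices.
\<close>

definition spanned_simplices ::
    "'k::finite itself \<Rightarrow> (real ^ 'd::finite) set \<Rightarrow> (real ^ 'd) set set" where
  "spanned_simplices TYPE('k) S =
     {T. T \<subseteq> S \<and> card T = CARD('k) + 1 \<and> \<not> affine_dependent T}"

definition simplex_volume :: "'k::finite itself \<Rightarrow> (real ^ 'd::finite) set \<Rightarrow> real" where
  "simplex_volume TYPE('k) T = flat_volume TYPE('k) (convex hull T)"

definition min_volume_simplices ::
    "'k::finite itself \<Rightarrow> (real ^ 'd::finite) set \<Rightarrow> (real ^ 'd) set set" where
  "min_volume_simplices TYPE('k) S =
     {T \<in> spanned_simplices TYPE('k) S.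
        simplex_volume TYPE('k) T = Min (simplex_volume TYPE('k) ` spanned_simplices TYPE('k) S)}"

end

theory Submission
  imports Defs
begin

text \<open>
  With a vertex \<open>a\<close> as base point, the squared volume of a \<open>k\<close>-simplex is its Gram determinant
  divided by \<open>(k!)\<^sup>2\<close>, so replacing one vertex scales the volume by the ratio of the distances of the
  new and the old vertex to the flat of the opposite facet.

  Upper bound: in each minimum simplex pick the vertex \<open>p\<close> of least height \<open>h\<close>, opposite a facet
  \<open>F\<close>; there are at most \<open>n\<^sup>k\<close> facets \<open>F\<close>. Since all heights are at least \<open>h\<close>, the barycentric
  coordinates of the foot of \<open>p\<close> with respect to \<open>F\<close> lie in \<open>[-1, 1]\<close>. If \<open>q\<close> is another such apex
  over \<open>F\<close> whose foot coordinates and whose unit normal direction are close to those of \<open>p\<close>, then for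
  every \<open>v \<in> F\<close> the point \<open>q\<close> is closer than \<open>v\<close> to the flat spanned by \<open>p\<close> and \<open>F - {v}\<close>, so by
  minimality it lies in that flat; these flats meet only in \<open>p\<close>. A grid of constant size therefore
  bounds the number of apexes over \<open>F\<close>.

  Lower bound: every nondegenerate simplex with integral vertices has a positive integral Gram
  determinant, hence volume at least \<open>1 / k!\<close>. On \<open>k\<close> parallel lines of equally spaced lattice points,
  two consecutive points of one line together with an arbitrary point on each other line attain this
  value.
\<close>

text \<open>
  A well-ordered index type of the cardinality of \<open>'a\<close>: \<open>content_simplex\<close> requires such index types.
\<close>

typedef 'a idx = "{..<CARD('a::finite)}"
  using zero_less_card_finite by blast

instantiation idx :: (finite) linorder
begin

definition "x \<le> y \<longleftrightarrow> Rep_idx x \<le> Rep_idx y"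
definition "x < y \<longleftrightarrow> Rep_idx x < Rep_idx y"

instance
  by intro_classes (auto simp: less_eq_idx_def less_idx_def Rep_idx_inject)

end

instance idx :: (finite) finite
  by intro_classes (metis finite_lessThan finite_imageI type_definition.univ type_definition_idx)

instance idx :: (finite) wellorder
proof -
  have "wf {(x :: 'a idx, y). x < y}"
    by (auto simp add: trancl_def tranclp_less intro!: finite_acyclic_wf acyclicI)
  thus "OFCLASS('a idx, wellorder_class)"
    by (rule wf_wellorderI) intro_classes
qed

lemma card_idx: "CARD('a::finite idx) = CARD('a)"
  by (metis card_lessThan type_definition.card type_definition_idx)

section \<open>Permutations of coordinates preserve Lebesgue measure\<close>

definition reindex :: "('m::finite \<Rightarrow> 'n::finite) \<Rightarrow> real ^ 'm \<Rightarrow> real ^ 'n" where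
  "reindex e x = (\<chi> i. x $ inv e i)"

lemma linear_reindex: "linear (reindex e)"
  by (rule linearI) (auto simp: reindex_def vec_eq_iff)

lemma prod_Basis_cart: "(\<Prod>b\<in>Basis. (x :: real ^ 'n::finite) \<bullet> b) = (\<Prod>i\<in>UNIV. x $ i)"
proof -
  have *: "bij_betw (\<lambda>i::'n. axis i (1::real)) UNIV Basis"
    by (auto simp: bij_betw_def inj_on_def axis_eq_axis Basis_vec_def)
  show ?thesis
    by (simp add: prod.reindex_bij_betw[OF *, symmetric] inner_axis inner_real_def)
qed

lemma bij_reindex:
  assumes "bij e"
  shows "bij (reindex e)"
proof (rule o_bij)
  show "(\<lambda>y. \<chi> j. y $ e j) \<circ> reindex e = id" "reindex e \<circ> (\<lambda>y. \<chi> j. y $ e j) = id"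
    using assms by (auto simp: reindex_def fun_eq_iff vec_eq_iff bij_is_inj bij_is_surj surj_f_inv_f)
qed

lemma norm_reindex:
  assumes "bij e"
  shows "norm (reindex e x) = norm x"
proof -
  have "(\<Sum>i\<in>UNIV. (x $ inv e i)\<^sup>2) = (\<Sum>j\<in>UNIV. (x $ j)\<^sup>2)"
    by (rule sum.reindex_bij_betw[OF bij_imp_bij_inv[OF assms]])
  then show ?thesis
    by (simp add: norm_vec_def L2_set_def reindex_def)
qed

text \<open>Lebesgue measure is determined by its values on boxes, and the preimage of a box is the
  box with its sides permuted. This carries volumes between \<open>real ^ 'k\<close>, where
  \<open>flat_volume\<close> measures, and \<open>real ^ 'k idx\<close>, where the simplex formula
  applies.\<close>

lemma lborel_distr_reindex:
  assumes e: "bij (e :: 'm::finite \<Rightarrow> 'n::finite)"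
  shows "distr lborel borel (reindex e) = lborel"
proof (rule lborel_eqI[symmetric])
  fix l u :: "real ^ 'n"
  assume le: "\<And>b. b \<in> Basis \<Longrightarrow> l \<bullet> b \<le> u \<bullet> b"
  have lu: "l $ i \<le> u $ i" for i
    using le[of "axis i 1"] by (simp add: inner_axis axis_in_Basis_iff)
  have "continuous_on UNIV (reindex e)"
    using linear_reindex linear_continuous_on linear_linear by blast
  then have meas: "reindex e \<in> borel_measurable lborel"
    using borel_measurable_continuous_onI by auto
  have vim: "reindex e -` box l u = box (\<chi> j. l $ e j) (\<chi> j. u $ e j)"
  proof -
    have "(\<forall>i. P i (inv e i)) \<longleftrightarrow> (\<forall>j. P (e j) j)" for P
      using e by (metis bij_inv_eq_iff)
    from this[of "\<lambda>i j. l $ i < x $ j \<and> x $ j < u $ i" for x] show ?thesis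
      by (auto simp: mem_box_cart reindex_def)
  qed
  have "emeasure (distr lborel borel (reindex e)) (box l u) = emeasure lborel (reindex e -` box l u)"
    using meas by (simp add: emeasure_distr)
  also have "\<dots> = (\<Prod>j\<in>UNIV. (u - l) $ e j)"
    unfolding vim 
    by (subst emeasure_lborel_box, force simp: lu Basis_vec_def inner_axis) (simp add: prod_Basis_cart)
  also have "(\<Prod>j\<in>UNIV. (u - l) $ e j) = (\<Prod>i\<in>UNIV. (u - l) $ i)"
    by (rule prod.reindex_bij_betw[OF e])
  finally show "emeasure (distr lborel borel (reindex e)) (box l u) = ennreal (\<Prod>b\<in>Basis. (u - l) \<bullet> b)"
    by (simp add: prod_Basis_cart)
qed simp

lemma measure_vimage_reindex:
  assumes "bij (e :: 'm::finite \<Rightarrow> 'n::finite)" "X \<in> sets borel"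
  shows "measure lborel (reindex e -` X) = measure lborel X"
proof -
  have "continuous_on UNIV (reindex e)"
    using linear_reindex linear_continuous_on linear_linear by blast
  then have meas: "reindex e \<in> borel_measurable lborel"
    using borel_measurable_continuous_onI by auto
  have "measure lborel X = measure (distr lborel borel (reindex e)) X"
    by (simp add: lborel_distr_reindex assms)
  also have "\<dots> = measure lborel (reindex e -` X)"
    using meas assms by (subst measure_distr) auto
  finally show ?thesis by simp
qed

subsection \<open>Gram determinants\<close>

definition gram :: "('n::finite \<Rightarrow> 'a::real_inner) \<Rightarrow> real" where
  "gram u = det (\<chi> i j. u i \<bullet> u j)"

text \<open>Row \<open>a\<close> is a linear image of \<open>u a\<close>, so the change adds to row
  \<open>i\<close> a combination of the other rows. The second family \<open>v\<close> is kept
  separate so that rows and, after transposition, columns can be treated one after the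
  other.\<close>

lemma det_inner_shift:
  fixes u v :: "'n::finite \<Rightarrow> 'a::real_inner"
  assumes "w - u i \<in> span (u ` (- {i}))"
  shows "det (\<chi> a b. (u(i := w)) a \<bullet> v b) = det (\<chi> a b. u a \<bullet> v b)"
proof -
  define L where "L x = (\<chi> b. x \<bullet> v b)" for x
  have "linear L"
    by (rule linearI) (auto simp: L_def vec_eq_iff inner_add_left)
  define M where "M = (\<chi> a b. u a \<bullet> v b)"
  have row: "row a M = L (u a)" for a
    by (simp add: row_def M_def L_def)
  have "L (w - u i) \<in> span (L ` u ` (- {i}))"
    using assms by (simp add: \<open>linear L\<close> linear_span_image)
  also have "L ` u ` (- {i}) = {row j M |j. j \<noteq> i}"
    by (auto simp: row)
  finally have "det (\<chi> k. if k = i then row i M + L (w - u i) else row k M) = det M"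
    using det_row_span[where x = "L (w - u i)" and i = i and A = M] by (simp add: span_vec_eq)
  also have "(\<chi> k. if k = i then row i M + L (w - u i) else row k M)
      = (\<chi> a b. (u(i := w)) a \<bullet> v b)"
    by (auto simp: vec_eq_iff row L_def inner_diff_left)
  finally show ?thesis
    by (simp add: M_def)
qed

lemma gram_shift:
  fixes u :: "'n::finite \<Rightarrow> 'a::real_inner"
  assumes "w - u i \<in> span (u ` (- {i}))"
  shows "gram (u(i := w)) = gram u"
proof -
  have tr: "transpose (\<chi> a b. x a \<bullet> y b) = (\<chi> a b. y a \<bullet> x b)" for x y :: "'n \<Rightarrow> 'a"
    by (auto simp: transpose_def vec_eq_iff inner_commute)
  have "gram (u(i := w)) = det (\<chi> a b. u a \<bullet> (u(i := w)) b)"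
    unfolding gram_def by (rule det_inner_shift[OF assms])
  also have "\<dots> = det (\<chi> a b. (u(i := w)) a \<bullet> u b)"
    by (metis det_transpose tr)
  also have "\<dots> = gram u"
    unfolding gram_def by (rule det_inner_shift[OF assms])
  finally show ?thesis .
qed

text \<open>Row and column \<open>i\<close> vanish off the diagonal, so the diagonal entry factors
  out. The cofactor \<open>K\<close> does not depend on \<open>w\<close>.\<close>

lemma gram_orthogonal:
  fixes u :: "'n::finite \<Rightarrow> 'a::real_inner"
  obtains K where "\<And>w. (\<And>j. j \<noteq> i \<Longrightarrow> w \<bullet> u j = 0) \<Longrightarrow> gram (u(i := w)) = (norm w)\<^sup>2 * K"
proof
  let ?b = "\<lambda>a. \<chi> b. if b = i then 0 else u a \<bullet> u b"
  fix w assume w: "\<And>j. j \<noteq> i \<Longrightarrow> w \<bullet> u j = 0"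
  have "(\<chi> a b. (u(i := w)) a \<bullet> (u(i := w)) b)
      = (\<chi> a. if a = i then (norm w)\<^sup>2 *s axis i 1 else ?b a)"
    using w by (auto simp: vec_eq_iff axis_def inner_commute power2_norm_eq_inner)
  then show "gram (u(i := w)) = (norm w)\<^sup>2 * det (\<chi> a. if a = i then axis i 1 else ?b a)"
    unfolding gram_def by (simp only: det_row_mul)
qed

lemma infdist_span:
  fixes X :: "'a::euclidean_space set"
  assumes "y \<in> span X" "\<And>x. x \<in> span X \<Longrightarrow> orthogonal z x"
  shows "infdist (y + z) (span X) = norm z"
proof (rule antisym)
  have "infdist (y + z) (span X) \<le> dist (y + z) y"
    using assms(1) by (rule infdist_le)
  then show "infdist (y + z) (span X) \<le> norm z"
    by (simp add: dist_norm)
  have "norm z \<le> dist (y + z) s" if "s \<in> span X" for s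
  proof -
    have "orthogonal (y - s) z"
      using assms that by (metis orthogonal_commute span_diff)
    then have "(norm ((y - s) + z))\<^sup>2 = (norm (y - s))\<^sup>2 + (norm z)\<^sup>2"
      by (rule norm_add_Pythagorean)
    then have "(norm z)\<^sup>2 \<le> (dist (y + z) s)\<^sup>2"
      by (simp add: dist_norm algebra_simps)
    then show ?thesis
      by (rule power2_le_imp_le) simp
  qed
  then show "norm z \<le> infdist (y + z) (span X)"
    using assms(1) by (subst infdist_notempty) (auto intro!: cINF_greatest)
qed

text \<open>Split \<open>w\<close> into a part in the span of the other vectors, which can be
  shifted away, and an orthogonal part, whose norm is the distance. Since one \<open>K\<close>
  serves all \<open>w\<close>, Gram determinants that differ in one vector compare like squared
  distances.\<close>

lemma gram_infdist:
  fixes u :: "'n::finite \<Rightarrow> 'a::euclidean_space"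
  obtains K where "\<And>w. gram (u(i := w)) = (infdist w (span (u ` (- {i}))))\<^sup>2 * K"
proof -
  obtain K where K: "\<And>w. (\<And>j. j \<noteq> i \<Longrightarrow> w \<bullet> u j = 0) \<Longrightarrow> gram (u(i := w)) = (norm w)\<^sup>2 * K"
    using gram_orthogonal[of i u] by blast
  have "gram (u(i := w)) = (infdist w (span (u ` (- {i}))))\<^sup>2 * K" for w
  proof -
    let ?S = "u ` (- {i})"
    obtain y z where yz: "y \<in> span ?S" "\<And>x. x \<in> span ?S \<Longrightarrow> orthogonal z x" "w = y + z"
      using orthogonal_subspace_decomp_exists[of ?S w] by metis
    have "gram (u(i := w)) = gram (u(i := z))"
      using gram_shift[of w "u(i := z)" i] yz by simp
    also have "\<dots> = (norm z)\<^sup>2 * K"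
    proof (rule K)
      fix j assume "j \<noteq> i"
      then have "u j \<in> span ?S" by (auto intro: span_base)
      then show "z \<bullet> u j = 0" using yz(2) by (simp add: orthogonal_def)
    qed
    finally show ?thesis
      using infdist_span[of y ?S z] yz by simp
  qed
  then show thesis using that by blast
qed

text \<open>A kernel vector of the Gram matrix gives a combination of the \<open>u i\<close> that is
  orthogonal to each \<open>u i\<close>, hence to itself, hence zero.\<close>

lemma gram_nonzero_iff:
  fixes u :: "'n::finite \<Rightarrow> 'a::real_inner"
  shows "gram u \<noteq> 0 \<longleftrightarrow> (\<forall>x. (\<Sum>i\<in>UNIV. x i *\<^sub>R u i) = 0 \<longrightarrow> (\<forall>i. x i = 0))"
proof -
  define M where "M = (\<chi> i j. u i \<bullet> u j)"
  have M: "M *v x = (\<chi> i. u i \<bullet> (\<Sum>j\<in>UNIV. x $ j *\<^sub>R u j))" for x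
    by (simp add: M_def matrix_vector_mult_def vec_eq_iff inner_sum_right mult.commute)
  have "gram u \<noteq> 0 \<longleftrightarrow> invertible M"
    by (simp add: gram_def M_def invertible_det_nz)
  also have "\<dots> \<longleftrightarrow> (\<forall>x. M *v x = 0 \<longrightarrow> x = 0)"
    by (simp add: invertible_left_inverse matrix_left_invertible_ker)
  also have "\<dots> \<longleftrightarrow> (\<forall>x::real^'n. (\<Sum>i\<in>UNIV. x $ i *\<^sub>R u i) = 0 \<longrightarrow> x = 0)"
  proof -
    have "M *v x = 0 \<longleftrightarrow> (\<Sum>i\<in>UNIV. x $ i *\<^sub>R u i) = 0" for x
    proof
      let ?s = "\<Sum>i\<in>UNIV. x $ i *\<^sub>R u i"
      assume "M *v x = 0"
      then have "u i \<bullet> ?s = 0" for i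
        unfolding M by (simp add: vec_eq_iff)
      then have "?s \<bullet> ?s = 0"
        by (subst inner_sum_left) simp
      then show "?s = 0" by simp
    qed (simp add: M vec_eq_iff)
    then show ?thesis by simp
  qed
  also have "\<dots> \<longleftrightarrow> (\<forall>x. (\<Sum>i\<in>UNIV. x i *\<^sub>R u i) = 0 \<longrightarrow> (\<forall>i. x i = 0))"
  proof safe
    fix x :: "'n \<Rightarrow> real" and i
    assume "\<forall>x::real^'n. (\<Sum>i\<in>UNIV. x $ i *\<^sub>R u i) = 0 \<longrightarrow> x = 0" "(\<Sum>i\<in>UNIV. x i *\<^sub>R u i) = 0"
    then show "x i = 0"
      by (auto simp: vec_eq_iff dest!: spec[of _ "\<chi> i. x i"])
  qed (simp add: vec_eq_iff)
  finally show ?thesis .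
qed

text \<open>Summing over indices also detects repetitions: \<open>u i = u j\<close> with distinct
  indices yields the nontrivial relation \<open>u i - u j = 0\<close>.\<close>

lemma inj_independent_iff:
  fixes u :: "'n::finite \<Rightarrow> 'a::real_vector"
  shows "inj u \<and> independent (range u)
    \<longleftrightarrow> (\<forall>x. (\<Sum>i\<in>UNIV. x i *\<^sub>R u i) = 0 \<longrightarrow> (\<forall>i. x i = 0))" (is "?A \<longleftrightarrow> ?B")
proof
  assume A: ?A
  show ?B
  proof (intro allI impI)
    fix x i assume "(\<Sum>i\<in>UNIV. x i *\<^sub>R u i) = 0"
    then have "(\<Sum>v\<in>range u. x (inv u v) *\<^sub>R v) = 0"
      using A by (subst sum.reindex) auto
    then have "x (inv u (u i)) = 0"
      using A by (intro independentD[of "range u" "range u" "\<lambda>v. x (inv u v)"]) auto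
    then show "x i = 0" using A by simp
  qed
next
  assume B: ?B
  have "inj u"
  proof (rule injI, rule ccontr)
    fix i j assume ij: "u i = u j" "i \<noteq> j"
    have "(\<Sum>a\<in>UNIV. (if a = i then 1 else if a = j then -1 else 0) *\<^sub>R u a)
        = (\<Sum>a\<in>{i,j}. (if a = i then 1 else if a = j then -1 else 0) *\<^sub>R u a)"
      by (rule sum.mono_neutral_right) auto
    also have "\<dots> = 0" using ij by auto
    finally show False using B[rule_format, of "\<lambda>a. if a = i then 1 else if a = j then -1 else 0" i] by simp
  qed
  moreover have "independent (range u)"
  proof (rule independent_if_scalars_zero)
    fix f v assume f: "(\<Sum>x\<in>range u. f x *\<^sub>R x) = 0" and v: "v \<in> range u"
    have "(\<Sum>i\<in>UNIV. f (u i) *\<^sub>R u i) = 0"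
      using f \<open>inj u\<close> by (subst (asm) sum.reindex) auto
    then show "f v = 0" using B[rule_format, of "\<lambda>i. f (u i)"] v by auto
  qed simp
  ultimately show ?A by blast
qed

lemma affine_independent_iff_gram:
  fixes p :: "'n::finite \<Rightarrow> 'a::real_inner"
  shows "inj p \<and> a \<notin> range p \<and> \<not> affine_dependent (insert a (range p)) \<longleftrightarrow> gram (\<lambda>i. p i - a) \<noteq> 0"
proof -
  have r: "range (\<lambda>i. p i - a) = (\<lambda>x. - a + x) ` range p" by auto
  have "gram (\<lambda>i. p i - a) \<noteq> 0 \<longleftrightarrow> inj (\<lambda>i. p i - a) \<and> independent (range (\<lambda>i. p i - a))"
    unfolding gram_nonzero_iff inj_independent_iff ..
  also have "inj (\<lambda>i. p i - a) \<longleftrightarrow> inj p"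
    by (auto simp: inj_on_def)
  finally have 1: "gram (\<lambda>i. p i - a) \<noteq> 0 \<longleftrightarrow> inj p \<and> independent (range (\<lambda>i. p i - a))" .
  show ?thesis
  proof (cases "a \<in> range p")
    case True
    then have "0 \<in> range (\<lambda>i. p i - a)" by force
    then show ?thesis unfolding 1 by (simp add: True dependent_zero)
  next
    case False
    then show ?thesis unfolding 1 affine_dependent_iff_dependent[OF False] r using False by (simp only: simp_thms)
  qed
qed

subsection \<open>Volumes of simplices\<close>

lemma inner_isometry:
  fixes L :: "'a::real_inner \<Rightarrow> 'b::real_inner"
  assumes "L 0 = 0" "\<And>x y. dist (L x) (L y) = dist x y"
  shows "L x \<bullet> L y = x \<bullet> y"
proof -
  have "norm (L x) = norm x" for x
    using assms(2)[of x 0] assms(1) by simp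
  then show ?thesis
    using assms(2)[of x y] by (simp add: dot_norm_neg dist_norm)
qed

text \<open>The squared norm of each linearity defect expands into inner products, which
  \<open>L\<close> preserves; the same expression without \<open>L\<close> is zero.\<close>

lemma linear_isometry:
  fixes L :: "'a::real_inner \<Rightarrow> 'b::real_inner"
  assumes "L 0 = 0" "\<And>x y. dist (L x) (L y) = dist x y"
  shows "linear L"
proof (rule linearI)
  note inner = inner_isometry[OF assms]
  fix x y c
  have "(L (x + y) - (L x + L y)) \<bullet> (L (x + y) - (L x + L y)) = 0"
    by (simp only: inner_diff_left inner_diff_right inner_add_left inner_add_right inner)
  then show "L (x + y) = L x + L y" by simp
  have "(L (c *\<^sub>R x) - c *\<^sub>R L x) \<bullet> (L (c *\<^sub>R x) - c *\<^sub>R L x) = 0"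
    by (simp only: inner_diff_left inner_diff_right inner_scaleR_left inner_scaleR_right inner) simp
  then show "L (c *\<^sub>R x) = c *\<^sub>R L x" by simp
qed

text \<open>Pulled back along an isometry, the simplex becomes full-dimensional with edge matrix
  \<open>M\<close> and volume \<bar>\<open>det M\<close>\<bar> / k!. Inner products survive the
  pullback, so the Gram determinant is the determinant of \<open>transpose M ** M\<close>, which is
  the square of \<open>det M\<close>.\<close>

lemma simplex_volume_eq_gram:
  fixes a :: "real ^ 'd::finite" and p :: "'k::finite idx \<Rightarrow> real ^ 'd"
  assumes g: "gram (\<lambda>i. p i - a) \<noteq> 0"
  shows "gram (\<lambda>i. p i - a) > 0"
    and "simplex_volume TYPE('k) (insert a (range p)) = sqrt (gram (\<lambda>i. p i - a)) / fact CARD('k)"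
proof -
  have p: "inj p" "a \<notin> range p" "\<not> affine_dependent (insert a (range p))"
    using g affine_independent_iff_gram[of p a] by auto
  let ?T = "insert a (range p)"
  let ?U = "(\<lambda>x. - a + x) ` range p"
  \<comment> \<open>The \<open>SOME\<close> in \<open>flat_volume\<close> is informative only once a
    suitable isometry exists. Here the edge vectors at \<open>a\<close> span a
    \<open>k\<close>-dimensional space, which is isometric to \<open>real ^ 'k\<close>.\<close>
  have "\<exists>f :: real ^ 'k \<Rightarrow> real ^ 'd. (\<forall>x y. dist (f x) (f y) = dist x y) \<and> convex hull ?T \<subseteq> range f"
  proof -
    have "independent ?U"
      using p affine_dependent_iff_dependent by blast
    moreover have "card ?U = CARD('k)"
      using p by (simp add: card_image card_idx)
    ultimately have "dim (UNIV :: (real ^ 'k) set) = dim (span ?U)"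
      by (simp add: dim_eq_card_independent)
    then obtain h :: "real ^ 'k \<Rightarrow> real ^ 'd"
      where h: "linear h" "h ` UNIV = span ?U" "\<And>x. norm (h x) = norm x"
      using isometries_subspaces[OF subspace_UNIV subspace_span] by (metis UNIV_I)
    have "dist (a + h x) (a + h y) = dist x y" for x y
      using h(3)[of "x - y"] by (simp add: dist_norm linear_diff[OF h(1)])
    moreover have "convex hull ?T \<subseteq> range (\<lambda>x. a + h x)"
    proof -
      have "affine hull ?T = (\<lambda>x. a + x) ` range h"
        unfolding affine_hull_insert_span_gen h(2) ..
      then show ?thesis
        using convex_hull_subset_affine_hull[of ?T] by (auto simp: image_image)
    qed
    ultimately show ?thesis
      by (intro exI[of _ "\<lambda>x. a + h x"] conjI allI)
  qed
  note f_ex = someI_ex[OF this]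
  define f :: "real ^ 'k \<Rightarrow> real ^ 'd"
    where "f = (SOME f. (\<forall>x y. dist (f x) (f y) = dist x y) \<and> convex hull ?T \<subseteq> range f)"
  have f: "dist (f x) (f y) = dist x y" "convex hull ?T \<subseteq> range f" for x y
    using f_ex unfolding f_def[symmetric] by blast+
  have vol: "simplex_volume TYPE('k) ?T = measure lebesgue (f -` (convex hull ?T))"
    unfolding simplex_volume_def flat_volume_def Let_def f_def ..
  obtain e :: "'k idx \<Rightarrow> 'k" where e: "bij e"
    using finite_same_card_bij[of "UNIV :: 'k idx set" "UNIV :: 'k set"] by (auto simp: card_idx)
  define F where "F = f \<circ> reindex e"
  have F: "dist (F x) (F y) = dist x y" for x y
    using norm_reindex[OF e, of "x - y"]
    by (simp add: F_def f(1)) (simp add: dist_norm linear_diff[OF linear_reindex])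
  have "range F = range f"
    unfolding F_def by (simp only: image_comp[symmetric] bij_is_surj[OF bij_reindex[OF e]])
  then have ran: "convex hull ?T \<subseteq> range F"
    using f by simp
  have "inj F"
    using F by (metis dist_eq_0_iff injI)
  have T: "?T \<subseteq> range F"
    using ran by (meson hull_subset order_trans)
  then obtain q0 where q0: "F q0 = a" by force
  have "p i \<in> range F" for i
    using T by auto
  then have "\<forall>i. \<exists>x. F x = p i"
    by (metis imageE)
  then obtain q where q: "\<And>i. F (q i) = p i" by metis
  \<comment> \<open>\<open>F\<close> is recentred so that \<open>q0\<close>, the preimage of
    \<open>a\<close>, and \<open>a\<close> itself both become origins; the result is an isometry
    fixing 0, hence linear, and \<open>F\<close> is affine.\<close>
  define L where "L x = F (x + q0) - a" for x
  have L0: "L 0 = 0" by (simp add: L_def q0)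
  have Ld: "dist (L x) (L y) = dist x y" for x y
    using F[of "x + q0" "y + q0"] by (simp add: L_def dist_norm)
  have "linear L"
    using L0 Ld by (rule linear_isometry)
  have FL: "F = (+) (a - L q0) \<circ> L"
  proof
    fix x
    have "L x - L q0 = F x - a"
      using linear_diff[OF \<open>linear L\<close>, of x q0] L_def[of "x - q0"] by simp
    then have "F x = a + (L x - L q0)"
      by simp
    then show "F x = ((+) (a - L q0) \<circ> L) x"
      by (simp add: algebra_simps)
  qed
  let ?X = "insert q0 (range q)"
  have FX: "F ` ?X = ?T"
    by (simp add: image_image q q0)
  have "F ` (convex hull ?X) = convex hull ?T"
    unfolding FX[symmetric] FL image_comp[symmetric]
    by (simp only: convex_hull_linear_image[OF \<open>linear L\<close>] convex_hull_translation)
  then have vim: "F -` (convex hull ?T) = convex hull ?X"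
    using \<open>inj F\<close> by (metis inj_vimage_image_eq)
  have "inj q"
    using p(1) q by (metis injD injI)
  have "q0 \<notin> range q"
    using p(2) q q0 by (metis rangeE rangeI)
  define M where "M = (\<chi> i j. q j $ i - q0 $ i)"
  have gr: "gram (\<lambda>i. p i - a) = (det M)\<^sup>2"
  proof -
    have "p i - a = L (q i - q0)" for i
      by (simp add: L_def q)
    then have "gram (\<lambda>i. p i - a) = gram (\<lambda>i. q i - q0)"
      by (simp add: gram_def inner_isometry[OF L0 Ld])
    also have "\<dots> = det (transpose M ** M)"
      unfolding gram_def
      by (rule arg_cong[where f = det])
         (simp add: vec_eq_iff matrix_matrix_mult_def transpose_def M_def inner_vec_def)
    finally show ?thesis
      by (simp add: det_mul power2_eq_square)
  qed
  then show "gram (\<lambda>i. p i - a) > 0"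
    using g by auto
  \<comment> \<open>The preimage is closed and therefore Borel, which permits the passage from
    \<open>lebesgue\<close> to \<open>lborel\<close> and then along
    \<open>reindex e\<close>.\<close>
  have "continuous_on UNIV f"
    using f(1) by (metis continuous_on_iff)
  moreover have "compact (convex hull ?T)"
    by (intro finite_imp_compact_convex_hull) auto
  ultimately have "closed (f -` (convex hull ?T))"
    by (intro closed_vimage compact_imp_closed) auto
  then have "measure lebesgue (f -` (convex hull ?T)) = measure lborel (f -` (convex hull ?T))"
    by (intro measure_completion) auto
  also have "\<dots> = measure lborel (reindex e -` f -` (convex hull ?T))"
    using \<open>closed (f -` (convex hull ?T))\<close> by (intro measure_vimage_reindex[OF e, symmetric]) auto
  also have "reindex e -` f -` (convex hull ?T) = convex hull ?X"
    using vim by (simp add: F_def vimage_comp)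
  also have "measure lborel (convex hull ?X) = \<bar>det M\<bar> / fact (CARD('k idx))"
    unfolding M_def
  proof (rule content_simplex)
    show "card ?X = Suc CARD('k idx)"
      using \<open>inj q\<close> \<open>q0 \<notin> range q\<close> by (simp add: card_image)
    show "bij_betw q UNIV (?X - {q0})"
      using \<open>inj q\<close> \<open>q0 \<notin> range q\<close> by (auto simp: bij_betw_def)
  qed auto
  finally show "simplex_volume TYPE('k) ?T = sqrt (gram (\<lambda>i. p i - a)) / fact CARD('k)"
    by (simp add: vol gr card_idx)
qed

lemma spanned_simplexE:
  fixes T :: "(real ^ 'd::finite) set"
  assumes "T \<in> spanned_simplices TYPE('k::finite) S" "a \<in> T"
  obtains p :: "'k::finite idx \<Rightarrow> real ^ 'd" where "bij_betw p UNIV (T - {a})" "T = insert a (range p)"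
    "gram (\<lambda>i. p i - a) \<noteq> 0"
proof -
  have T: "card T = CARD('k) + 1" "\<not> affine_dependent T"
    using assms by (auto simp: spanned_simplices_def)
  have "finite T"
    using T(2) by (rule aff_independent_finite)
  then obtain p :: "'k idx \<Rightarrow> real ^ 'd" where p: "bij_betw p UNIV (T - {a})"
    using finite_same_card_bij[of "UNIV :: 'k idx set" "T - {a}"] T assms(2) by (auto simp: card_idx)
  then have "T = insert a (range p)" "inj p" "a \<notin> range p"
    using assms(2) by (auto simp: bij_betw_def)
  then show thesis
    using that[OF p] T affine_independent_iff_gram[of p a] by blast
qed

text \<open>With a base vertex in the facet opposite \<open>v\<close>, both Gram determinants are
  squared distances to that facet's flat times the same \<open>K\<close>. The old simplex is
  nondegenerate, so \<open>K\<close> is positive; \<open>q\<close> lies off the closed flat, so the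
  new one is nondegenerate too.\<close>

lemma simplex_volume_exchange:
  fixes T :: "(real ^ 'd::finite) set"
  assumes T: "T \<in> spanned_simplices TYPE('k::finite) S" and v: "v \<in> T"
    and q: "q \<notin> affine hull (T - {v})"
    and less: "infdist q (affine hull (T - {v})) < infdist v (affine hull (T - {v}))"
  shows "card (insert q (T - {v})) = CARD('k) + 1" "\<not> affine_dependent (insert q (T - {v}))"
    "simplex_volume TYPE('k) (insert q (T - {v})) < simplex_volume TYPE('k) T"
proof -
  let ?H = "affine hull (T - {v})"
  have card: "card T = CARD('k) + 1" "\<not> affine_dependent T"
    using T by (auto simp: spanned_simplices_def)
  have fin: "finite T"
    using card(2) by (rule aff_independent_finite)
  have "q \<notin> T - {v}"
    using q by (meson hull_inc)
  then show "card (insert q (T - {v})) = CARD('k) + 1"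
    using fin card v by simp
  have "card (T - {v}) \<noteq> 0"
    using fin card v by simp
  \<comment> \<open>The base vertex must differ from \<open>v\<close>, so that the exchange changes
    just one edge vector; it exists because k \<ge> 1.\<close>
  then obtain a where a: "a \<in> T" "a \<noteq> v"
    by (metis DiffE all_not_in_conv card.empty singletonI)
  obtain p :: "'k idx \<Rightarrow> real ^ 'd" where p: "bij_betw p UNIV (T - {a})" "T = insert a (range p)"
    "gram (\<lambda>i. p i - a) \<noteq> 0"
    using spanned_simplexE[OF T a(1)] .
  then obtain i where i: "p i = v"
    using v a by auto
  have inj: "inj p" "a \<notin> range p"
    using p(1) by (auto simp: bij_betw_def)
  have Tv: "T - {v} = insert a (p ` (- {i}))"
    using p(2) i a inj by (auto simp: inj_on_def)
  have T': "insert q (T - {v}) = insert a (range (p(i := q)))"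
    unfolding Tv by (auto simp: image_iff)
  let ?u = "\<lambda>i. p i - a"
  let ?W = "span (?u ` (- {i}))"
  have H: "?H = (+) a ` ?W"
    unfolding Tv affine_hull_insert_span_gen by (simp add: image_image)
  have inf: "infdist x ?H = infdist (x - a) ?W" for x
  proof -
    have "dist x (a + w) = dist (x - a) w" for w
      by (simp add: dist_norm algebra_simps)
    then show ?thesis
      unfolding H infdist_def by (simp add: image_image)
  qed
  obtain K where K: "\<And>w. gram (?u(i := w)) = (infdist w ?W)\<^sup>2 * K"
    using gram_infdist[of ?u i] by blast
  have gT: "gram ?u = (infdist (v - a) ?W)\<^sup>2 * K"
    using K[of "v - a"] i by (metis fun_upd_triv)
  have u': "(\<lambda>j. (p(i := q)) j - a) = ?u(i := q - a)"
    by auto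
  have gT': "gram (\<lambda>j. (p(i := q)) j - a) = (infdist (q - a) ?W)\<^sup>2 * K"
    unfolding u' by (rule K)
  have "gram ?u > 0"
    using simplex_volume_eq_gram(1)[OF p(3)] .
  then have "K > 0"
    unfolding gT by (simp add: zero_less_mult_iff)
  have "q - a \<notin> ?W"
  proof
    assume "q - a \<in> ?W"
    then have "a + (q - a) \<in> ?H"
      unfolding H by (rule imageI)
    then show False using q by simp
  qed
  then have "infdist (q - a) ?W \<noteq> 0"
    using in_closed_iff_infdist_zero[OF closed_span, of "?u ` (- {i})" "q - a"] span_zero by auto
  with \<open>K > 0\<close> have nz: "gram (\<lambda>j. (p(i := q)) j - a) \<noteq> 0"
    unfolding gT' by simp
  then show "\<not> affine_dependent (insert q (T - {v}))"
    unfolding T' using affine_independent_iff_gram by blast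
  have "infdist (q - a) ?W < infdist (v - a) ?W"
    using less by (simp add: inf)
  then have "(infdist (q - a) ?W)\<^sup>2 < (infdist (v - a) ?W)\<^sup>2"
    by (intro power_strict_mono) (auto simp: infdist_nonneg)
  then have "gram (\<lambda>j. (p(i := q)) j - a) < gram ?u"
    unfolding gT gT' using \<open>K > 0\<close> by simp
  moreover have "simplex_volume TYPE('k) (insert q (T - {v}))
      = sqrt (gram (\<lambda>j. (p(i := q)) j - a)) / fact CARD('k)"
    unfolding T' by (rule simplex_volume_eq_gram(2)[OF nz])
  moreover have "simplex_volume TYPE('k) T = sqrt (gram ?u) / fact CARD('k)"
    unfolding p(2) by (rule simplex_volume_eq_gram(2)[OF p(3)])
  ultimately show "simplex_volume TYPE('k) (insert q (T - {v})) < simplex_volume TYPE('k) T"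
    by (simp add: divide_strict_right_mono)
qed

subsection \<open>The upper bound\<close>

text \<open>The differences are directions of \<open>H\<close>, so the coefficients are
  unconstrained. This certifies below that explicitly built points lie on facet flats.\<close>

lemma affine_add_sum_diff:
  assumes "affine H" "p \<in> H" "finite F" "\<And>w. w \<in> F \<Longrightarrow> g w \<in> H"
  shows "p + (\<Sum>w\<in>F. c w *\<^sub>R (g w - p)) \<in> H"
  using assms(3,4)
proof (induction F rule: finite_induct)
  case (insert w F)
  have "(p + (\<Sum>w\<in>F. c w *\<^sub>R (g w - p))) + c w *\<^sub>R (g w - p) \<in> H"
    using insert by (intro mem_affine_3_minus assms(1,2)) auto
  then show ?case
    using insert by (simp add: algebra_simps)
qed (simp add: assms)

text \<open>
  If \<open>x v\<close> exceeded 1 in absolute value, solving the representation of \<open>p\<close> for \<open>v\<close> would show that \<open>v\<close>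
  has distance at most \<open>norm z / \<bar>x v\<bar>\<close> from the opposite flat.
\<close>

lemma foot_coordinate_le_1:
  fixes F :: "'a::euclidean_space set"
  assumes F: "finite F" "v \<in> F" and x: "sum x F = 1" and p: "p = (\<Sum>w\<in>F. x w *\<^sub>R w) + z"
    and z: "z \<noteq> 0" "norm z \<le> infdist v (affine hull (insert p (F - {v})))"
  shows "\<bar>x v\<bar> \<le> 1"
proof (rule ccontr)
  assume gt: "\<not> \<bar>x v\<bar> \<le> 1"
  define s where "s = (\<Sum>w\<in>F - {v}. x w *\<^sub>R w)"
  have s: "p = x v *\<^sub>R v + s + z"
    unfolding p s_def using F by (simp add: sum.remove)
  have "(\<Sum>w\<in>F - {v}. (- x w / x v) *\<^sub>R (w - p))
      = (- 1 / x v) *\<^sub>R (\<Sum>w\<in>F - {v}. x w *\<^sub>R w - x w *\<^sub>R p)"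
    by (simp add: scaleR_sum_right algebra_simps)
  also have "\<dots> = (- 1 / x v) *\<^sub>R (s - sum x (F - {v}) *\<^sub>R p)"
    by (simp add: sum_subtractf s_def scaleR_sum_left)
  also have "sum x (F - {v}) = 1 - x v"
    using F x by (simp add: sum.remove)
  also have "s - (1 - x v) *\<^sub>R p = x v *\<^sub>R p - x v *\<^sub>R v - z"
    using s by (simp add: algebra_simps)
  also have "(- 1 / x v) *\<^sub>R \<dots> = v + (1 / x v) *\<^sub>R z - p"
    using gt by (auto simp: scaleR_diff_right)
  finally have "p + (\<Sum>w\<in>F - {v}. (- x w / x v) *\<^sub>R (w - p)) = v + (1 / x v) *\<^sub>R z"
    by (simp only: add_diff_cancel_left' add_diff_eq)
  then have "v + (1 / x v) *\<^sub>R z \<in> affine hull (insert p (F - {v}))"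
    using affine_add_sum_diff[of "affine hull (insert p (F - {v}))" p "F - {v}" "\<lambda>w. w" "\<lambda>w. - x w / x v"]
    by (simp add: F hull_inc)
  then have "infdist v (affine hull (insert p (F - {v}))) \<le> dist v (v + (1 / x v) *\<^sub>R z)"
    by (rule infdist_le)
  also have "\<dots> = norm z / \<bar>x v\<bar>"
    by (simp add: dist_norm)
  also have "\<dots> < norm z"
    using gt z by (simp add: field_simps)
  finally show False
    using z by simp
qed

text \<open>Assumption \<open>far\<close> is what minimality of the simplex provides. Closeness of
  \<open>q\<close> to \<open>p\<close> contradicts it for each \<open>v\<close> unless
  \<open>q\<close> lies on the flat opposite \<open>v\<close>; by affine independence these flats
  share only \<open>p\<close>.\<close>

lemma apex_unique:
  fixes F :: "'a::euclidean_space set"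
  assumes ind: "\<not> affine_dependent (insert p F)" and "p \<notin> F"
    and x: "sum x F = 1" "p = (\<Sum>w\<in>F. x w *\<^sub>R w) + z"
    and y: "sum y F = 1" "q = (\<Sum>w\<in>F. y w *\<^sub>R w) + z'"
    and close: "\<And>v. v \<in> F \<Longrightarrow> \<bar>y v - x v\<bar> \<le> 1 / 2" "norm (z' - z) < h / 2"
    and h: "\<And>v. v \<in> F \<Longrightarrow> h \<le> infdist v (affine hull (insert p (F - {v})))"
    and far: "\<And>v. v \<in> F \<Longrightarrow> q \<notin> affine hull (insert p (F - {v})) \<Longrightarrow>
      infdist v (affine hull (insert p (F - {v}))) \<le> infdist q (affine hull (insert p (F - {v})))"
  shows "q = p"
proof -
  have fin: "finite F"
    using aff_independent_finite[OF ind] by simp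
  have "F \<noteq> {}"
    using x(1) by auto
  have mem: "q \<in> affine hull (insert p (F - {v}))" if v: "v \<in> F" for v
  proof (rule ccontr)
    let ?H = "affine hull (insert p (F - {v}))"
    assume q: "q \<notin> ?H"
    obtain m where m: "m \<in> ?H" "infdist v ?H = dist v m"
      using infdist_attains_inf[of ?H v] by auto
    define c where "c w = y w - x w" for w
    \<comment> \<open>The displacement from \<open>p\<close> to \<open>q\<close> is imitated inside
      the flat: \<open>r\<close> uses the coordinate differences \<open>c\<close>, but with
      \<open>v\<close> replaced by its nearest point \<open>m\<close>. Then \<open>q - r\<close>
      consists only of \<open>c v\<close> times \<open>v - m\<close> and the change
      \<open>z' - z\<close>.\<close>
    define g where "g w = (if w = v then m else w)" for w
    define r where "r = p + (\<Sum>w\<in>F. c w *\<^sub>R (g w - p))"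
    have "r \<in> ?H"
      unfolding r_def
      by (rule affine_add_sum_diff) (auto simp: fin g_def m hull_inc)
    have c0: "sum c F = 0"
      using x y by (simp add: c_def sum_subtractf)
    have "r = p + (\<Sum>w\<in>F. c w *\<^sub>R g w) - sum c F *\<^sub>R p"
      unfolding r_def by (simp add: scaleR_diff_right sum_subtractf scaleR_sum_left)
    then have r: "r = p + (\<Sum>w\<in>F. c w *\<^sub>R g w)"
      by (simp add: c0)
    have q': "q = p + (\<Sum>w\<in>F. c w *\<^sub>R w) + (z' - z)"
      unfolding x(2) y(2) by (simp add: c_def scaleR_diff_left sum_subtractf)
    have "(\<Sum>w\<in>F. c w *\<^sub>R w) - (\<Sum>w\<in>F. c w *\<^sub>R g w) = (\<Sum>w\<in>F. c w *\<^sub>R (w - g w))"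
      by (simp add: scaleR_diff_right sum_subtractf)
    also have "\<dots> = c v *\<^sub>R (v - m)"
      using fin v by (subst sum.remove[of F v]) (auto simp: g_def)
    finally have "q - r = c v *\<^sub>R (v - m) + (z' - z)"
      unfolding q' r by (simp add: algebra_simps)
    then have "dist q r \<le> \<bar>c v\<bar> * dist v m + norm (z' - z)"
      by (metis dist_norm norm_scaleR norm_triangle_ineq)
    also have "\<dots> < 1 / 2 * dist v m + h / 2"
      \<comment> \<open>Each of the two error terms gets half of \<open>dist v m\<close>, which is
        at least \<open>h\<close>; strictness comes from the bound on \<open>z' - z\<close>.\<close>
      using close(1)[OF v] close(2) by (intro add_le_less_mono mult_right_mono) (auto simp: c_def)
    also have "\<dots> \<le> dist v m"
      using h[OF v] m(2) by simp
    finally have "infdist q ?H < infdist v ?H"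
      using infdist_le[OF \<open>r \<in> ?H\<close>, of q] m(2) by simp
    then show False
      using far[OF v q] by simp
  qed
  \<comment> \<open>For affinely independent points, affine hulls of subsets intersect in the hull
    of the common points. Each \<open>v\<close> is missing from its own set, so only
    \<open>p\<close> is common.\<close>
  let ?\<S> = "(\<lambda>v. insert p (F - {v})) ` F"
  have "\<not> affine_dependent (\<Union>?\<S>)"
    by (rule affine_independent_subset[OF ind]) auto
  then have "affine hull (\<Inter>?\<S>) = (\<Inter>T\<in>?\<S>. affine hull T)"
    by (rule affine_hull_Inter)
  moreover have "\<Inter>?\<S> = {p}"
    using \<open>F \<noteq> {}\<close> \<open>p \<notin> F\<close> by auto
  moreover have "q \<in> (\<Inter>T\<in>?\<S>. affine hull T)"
    using mem by blast
  ultimately show ?thesis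
    by (metis affine_hull_sing singletonD)
qed

section \<open>Minimality under vertex exchange and the number of apexes over a facet\<close>

lemma finite_spanned_simplices: "finite S \<Longrightarrow> finite (spanned_simplices TYPE('k::finite) S)"
  by (rule finite_subset[of _ "Pow S"]) (auto simp: spanned_simplices_def)

lemma min_volume_le:
  assumes "finite S" "T \<in> min_volume_simplices TYPE('k::finite) S" "T' \<in> spanned_simplices TYPE('k) S"
  shows "simplex_volume TYPE('k) T \<le> simplex_volume TYPE('k) T'"
  using assms by (simp add: min_volume_simplices_def finite_spanned_simplices)

text \<open>Otherwise exchanging \<open>v\<close> for the closer point \<open>q\<close> would give a
  nondegenerate simplex of smaller volume spanned by \<open>S\<close>.\<close>

lemma min_volume_exchange:
  fixes S :: "(real ^ 'd::finite) set"
  assumes S: "finite S" and T: "T \<in> min_volume_simplices TYPE('k::finite) S" and v: "v \<in> T"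
    and q: "q \<in> S" "q \<notin> affine hull (T - {v})"
  shows "infdist v (affine hull (T - {v})) \<le> infdist q (affine hull (T - {v}))"
proof (rule ccontr)
  assume "\<not> ?thesis"
  then have less: "infdist q (affine hull (T - {v})) < infdist v (affine hull (T - {v}))"
    by simp
  have T': "T \<in> spanned_simplices TYPE('k) S"
    using T by (simp add: min_volume_simplices_def)
  note ex = simplex_volume_exchange[OF T' v q(2) less]
  have "insert q (T - {v}) \<in> spanned_simplices TYPE('k) S"
    using ex(1,2) T' q(1) by (auto simp: spanned_simplices_def)
  from min_volume_le[OF S T this] ex(3) show False by simp
qed

text \<open>For \<open>v\<close> in \<open>F\<close>, \<open>insert p (F - {v})\<close> is the facet
  opposite \<open>v\<close>, so the last condition says that \<open>p\<close> has least height among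
  the vertices of the simplex.\<close>

definition low_apexes :: "'k::finite itself \<Rightarrow> (real ^ 'd::finite) set \<Rightarrow> (real ^ 'd) set \<Rightarrow> (real ^ 'd) set" where
  "low_apexes TYPE('k) S F = {p. p \<notin> F \<and> insert p F \<in> min_volume_simplices TYPE('k) S \<and>
     (\<forall>v\<in>F. infdist p (affine hull F) \<le> infdist v (affine hull (insert p (F - {v}))))}"

text \<open>Take a nearest point of \<open>affine hull F\<close> as foot and let \<open>z\<close>
  join it to \<open>p\<close>. As \<open>p\<close> has least height, \<open>norm z\<close> is at
  most the height of each \<open>v\<close>, which bounds the coordinates by 1.\<close>

lemma low_apex_coordinates:
  fixes S :: "(real ^ 'd::finite) set"
  assumes "p \<in> low_apexes TYPE('k::finite) S F"
  obtains x z where "sum x F = 1" "p = (\<Sum>w\<in>F. x w *\<^sub>R w) + z"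
    "norm z = infdist p (affine hull F)" "z \<noteq> 0" "\<And>v. v \<in> F \<Longrightarrow> \<bar>x v\<bar> \<le> 1"
proof -
  have p: "p \<notin> F" "insert p F \<in> spanned_simplices TYPE('k) S"
    and low: "\<And>v. v \<in> F \<Longrightarrow> infdist p (affine hull F) \<le> infdist v (affine hull (insert p (F - {v})))"
    using assms by (auto simp: low_apexes_def min_volume_simplices_def)
  have ind: "\<not> affine_dependent (insert p F)" and card: "card (insert p F) = CARD('k) + 1"
    using p by (auto simp: spanned_simplices_def)
  have fin: "finite F"
    using aff_independent_finite[OF ind] by simp
  have "F \<noteq> {}"
    using card by auto
  then have ne: "affine hull F \<noteq> {}" by simp
  have notin: "p \<notin> affine hull F"
    using ind p(1) unfolding affine_dependent_def by force
  obtain f where f: "f \<in> affine hull F" "infdist p (affine hull F) = dist p f"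
    using infdist_attains_inf[OF closed_affine_hull ne] by blast
  obtain x where x: "sum x F = 1" "(\<Sum>w\<in>F. x w *\<^sub>R w) = f"
    using f(1) unfolding affine_hull_finite[OF fin] by auto
  have z: "p - f \<noteq> 0"
    using f(1) notin by auto
  have eq: "p = (\<Sum>w\<in>F. x w *\<^sub>R w) + (p - f)"
    by (simp add: x)
  show thesis
  proof (rule that[OF x(1) eq _ z])
    show "norm (p - f) = infdist p (affine hull F)"
      by (simp add: f dist_norm)
    then show "\<bar>x v\<bar> \<le> 1" if "v \<in> F" for v
      using foot_coordinate_le_1[OF fin that x(1) eq z] low[OF that] by simp
  qed
qed

lemma floor_eq_imp_abs_diff_less_1:
  fixes a b :: real
  assumes "\<lfloor>a\<rfloor> = \<lfloor>b\<rfloor>"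
  shows "\<bar>a - b\<bar> < 1"
  using assms by linarith

lemma floor_mem_symmetric_interval:
  fixes a :: real
  assumes "\<bar>a\<bar> \<le> real m"
  shows "\<lfloor>a\<rfloor> \<in> {- int m..int m}"
proof -
  have "\<lfloor>- real m\<rfloor> \<le> \<lfloor>a\<rfloor>" "\<lfloor>a\<rfloor> \<le> \<lfloor>real m\<rfloor>"
    using assms by (intro floor_mono; simp add: abs_le_iff)+
  moreover have "\<lfloor>- real m\<rfloor> = - int m"
    by (metis floor_of_int of_int_minus of_int_of_nat_eq)
  ultimately show ?thesis by simp
qed

text \<open>An apex is encoded by rounding its foot coordinates and its unit normal; equal codes
  satisfy the closeness conditions of \<open>apex_unique\<close>. There are 5 values for each of the
  \<open>k\<close> foot coordinates and 4d + 1 for each of the \<open>d\<close> normal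
  components.\<close>

lemma card_low_apexes:
  fixes S :: "(real ^ 'd::finite) set"
  assumes S: "finite S" and F: "card F = CARD('k::finite)"
  shows "card (low_apexes TYPE('k) S F) \<le> 5 ^ CARD('k) * (4 * CARD('d) + 1) ^ CARD('d)"
proof -
  let ?P = "low_apexes TYPE('k) S F"
  let ?h = "\<lambda>p. infdist p (affine hull F)"
  \<comment> \<open>With mesh 1 / \<open>N\<close> = 1 / (2d), the \<open>d\<close> component errors
    add up to less than half the height.\<close>
  define N :: real where "N = real (2 * CARD('d))"
  have N: "N > 0" by (simp add: N_def)
  have "finite F"
    using F card.infinite by fastforce
  have "\<forall>p\<in>?P. \<exists>x z. sum x F = 1 \<and> p = (\<Sum>w\<in>F. x w *\<^sub>R w) + z \<and> norm z = ?h p \<and> z \<noteq> 0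
      \<and> (\<forall>v\<in>F. \<bar>x v\<bar> \<le> 1)"
  proof
    fix p assume "p \<in> ?P"
    from low_apex_coordinates[OF this] obtain x z where "sum x F = 1"
      "p = (\<Sum>w\<in>F. x w *\<^sub>R w) + z" "norm z = ?h p" "z \<noteq> 0" "\<And>v. v \<in> F \<Longrightarrow> \<bar>x v\<bar> \<le> 1"
      by blast
    then show "\<exists>x z. sum x F = 1 \<and> p = (\<Sum>w\<in>F. x w *\<^sub>R w) + z \<and> norm z = ?h p \<and> z \<noteq> 0
        \<and> (\<forall>v\<in>F. \<bar>x v\<bar> \<le> 1)"
      by (intro exI[of _ x] exI[of _ z]) simp
  qed
  then obtain x z where xz: "\<And>p. p \<in> ?P \<Longrightarrow> sum (x p) F = 1 \<and> p = (\<Sum>w\<in>F. x p w *\<^sub>R w) + z p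
      \<and> norm (z p) = ?h p \<and> z p \<noteq> 0 \<and> (\<forall>v\<in>F. \<bar>x p v\<bar> \<le> 1)"
    unfolding bchoice_iff by blast
  have pos: "?h p > 0" if "p \<in> ?P" for p
    using xz[OF that] by (metis zero_less_norm_iff)
  define \<kappa> where "\<kappa> p = (\<lambda>v\<in>F. \<lfloor>2 * x p v\<rfloor>, \<lambda>i::'d. \<lfloor>N * (z p $ i / ?h p)\<rfloor>)" for p
  let ?K = "(F \<rightarrow>\<^sub>E {-2..2::int}) \<times> ((UNIV :: 'd set) \<rightarrow>\<^sub>E {- int (2 * CARD('d))..int (2 * CARD('d))})"
  have "\<kappa> ` ?P \<subseteq> ?K"
  proof (rule image_subsetI)
    fix p assume p: "p \<in> ?P"
    have "\<lfloor>2 * x p v\<rfloor> \<in> {-2..2}" if "v \<in> F" for v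
      using xz[OF p] that by (auto simp: abs_le_iff le_floor_iff floor_le_iff dest!: bspec)
    moreover have "\<lfloor>N * (z p $ i / ?h p)\<rfloor> \<in> {- int (2 * CARD('d))..int (2 * CARD('d))}" for i
    proof -
      have "\<bar>z p $ i / ?h p\<bar> \<le> 1"
        using component_le_norm_cart[of "z p" i] xz[OF p] pos[OF p] by simp
      then have "\<bar>N * (z p $ i / ?h p)\<bar> \<le> N"
        using N mult_left_mono[of "\<bar>z p $ i / ?h p\<bar>" 1 N] by (simp add: abs_mult)
      then show ?thesis
        unfolding N_def by (rule floor_mem_symmetric_interval)
    qed
    ultimately show "\<kappa> p \<in> ?K"
      by (auto simp: \<kappa>_def)
  qed
  moreover have "inj_on \<kappa> ?P"
  proof (rule inj_onI)
    fix p q assume p: "p \<in> ?P" and q: "q \<in> ?P" and \<kappa>: "\<kappa> p = \<kappa> q"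
    have sp: "r \<notin> F" "insert r F \<in> min_volume_simplices TYPE('k) S"
      "insert r F \<in> spanned_simplices TYPE('k) S" "r \<in> S" if "r \<in> ?P" for r
      using that by (auto simp: low_apexes_def min_volume_simplices_def spanned_simplices_def)
    \<comment> \<open>Exchanging the apexes in either direction shows that all apexes over
      \<open>F\<close> have the same height, so their normals are rounded on one scale.\<close>
    have le: "?h r \<le> ?h s" if r: "r \<in> ?P" and s: "s \<in> ?P" for r s
    proof -
      have "insert r F - {r} = F"
        using sp(1)[OF r] by simp
      moreover have "s \<notin> affine hull F"
        using pos[OF s] by (auto simp: infdist_zero)
      ultimately show ?thesis
        using min_volume_exchange[OF S sp(2)[OF r] _ sp(4)[OF s], of r] by simp
    qed
    have h: "?h q = ?h p"
      using le p q by (meson order_antisym)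
    have "q = p"
    proof (rule apex_unique[where h = "?h p"])
      show "\<not> affine_dependent (insert p F)" "p \<notin> F"
        using sp[OF p] by (auto simp: spanned_simplices_def)
      show "sum (x p) F = 1" "p = (\<Sum>w\<in>F. x p w *\<^sub>R w) + z p"
        using xz[OF p] by auto
      show "sum (x q) F = 1" "q = (\<Sum>w\<in>F. x q w *\<^sub>R w) + z q"
        using xz[OF q] by auto
      fix v assume v: "v \<in> F"
      have "\<lfloor>2 * x q v\<rfloor> = \<lfloor>2 * x p v\<rfloor>"
        using arg_cong[OF \<kappa>, of "\<lambda>k. fst k v"] v by (simp add: \<kappa>_def)
      from floor_eq_imp_abs_diff_less_1[OF this] show "\<bar>x q v - x p v\<bar> \<le> 1 / 2"
        by linarith
      show "?h p \<le> infdist v (affine hull (insert p (F - {v})))"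
        using p v by (simp add: low_apexes_def)
      have "insert p F - {v} = insert p (F - {v})"
        using v sp(1)[OF p] by auto
      then show "infdist v (affine hull (insert p (F - {v}))) \<le> infdist q (affine hull (insert p (F - {v})))"
        if "q \<notin> affine hull (insert p (F - {v}))"
        using min_volume_exchange[OF S sp(2)[OF p] _ sp(4)[OF q], of v] v that by simp
    next
      have "\<bar>(z q - z p) $ i\<bar> < ?h p / N" for i
      proof -
        have "\<lfloor>N * (z q $ i / ?h p)\<rfloor> = \<lfloor>N * (z p $ i / ?h p)\<rfloor>"
          using arg_cong[OF \<kappa>, of "\<lambda>k. snd k i"] h by (simp add: \<kappa>_def)
        from floor_eq_imp_abs_diff_less_1[OF this]
        have "\<bar>(N / ?h p) * ((z q - z p) $ i)\<bar> < 1"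
          by (simp add: algebra_simps diff_divide_distrib)
        then have "(N / ?h p) * \<bar>(z q - z p) $ i\<bar> < 1"
          using N pos[OF p] by (simp add: abs_mult)
        then show ?thesis
          using N pos[OF p] by (simp add: field_simps)
      qed
      then have "(\<Sum>i\<in>UNIV. \<bar>(z q - z p) $ i\<bar>) < (\<Sum>i\<in>(UNIV :: 'd set). ?h p / N)"
        by (intro sum_strict_mono) auto
      also have "\<dots> = ?h p / 2"
        by (simp add: N_def)
      finally show "norm (z q - z p) < ?h p / 2"
        using norm_le_l1_cart[of "z q - z p"] by linarith
    qed
    then show "p = q" ..
  qed
  moreover have "finite ?K"
    using \<open>finite F\<close> by (intro finite_cartesian_product finite_PiE) auto
  ultimately have "card ?P \<le> card ?K"
    by (metis card_inj_on_le)
  then show ?thesis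
    using \<open>finite F\<close> by (simp add: card_cartesian_product card_PiE F nat_add_distrib nat_mult_distrib)
qed

text \<open>In each minimum simplex a vertex of least height is a low apex over its opposite
  facet.\<close>

lemma min_volume_subset_low_apexes:
  fixes S :: "(real ^ 'd::finite) set"
  shows "min_volume_simplices TYPE('k::finite) S
    \<subseteq> (\<Union>F\<in>{F. F \<subseteq> S \<and> card F = CARD('k)}. (\<lambda>p. insert p F) ` low_apexes TYPE('k) S F)"
proof
  fix T assume T: "T \<in> min_volume_simplices TYPE('k) S"
  then have TS: "T \<subseteq> S" "card T = CARD('k) + 1"
    by (auto simp: min_volume_simplices_def spanned_simplices_def)
  then have fin: "finite T" "T \<noteq> {}"
    using card.infinite by fastforce+
  let ?g = "\<lambda>v. infdist v (affine hull (T - {v}))"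
  define p where "p = arg_min_on ?g T"
  have p: "p \<in> T" "\<And>v. v \<in> T \<Longrightarrow> infdist p (affine hull (T - {p})) \<le> infdist v (affine hull (T - {v}))"
    unfolding p_def using arg_min_if_finite[OF fin, of ?g] by (auto simp: not_less)
  let ?F = "T - {p}"
  have ins: "insert p ?F = T"
    using p by auto
  have "insert p (?F - {v}) = T - {v}" if "v \<in> ?F" for v
    using that p by auto
  then have "p \<in> low_apexes TYPE('k) S ?F"
    using p T by (auto simp: low_apexes_def insert_absorb)
  moreover have "?F \<subseteq> S" "card ?F = CARD('k)"
    using TS p fin by auto
  ultimately show "T \<in> (\<Union>F\<in>{F. F \<subseteq> S \<and> card F = CARD('k)}. (\<lambda>p. insert p F) ` low_apexes TYPE('k) S F)"
    using ins by (intro UN_I[of ?F]) (auto intro: image_eqI[where x = p])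
qed

text \<open>Sum the bound for one facet over all \<open>k\<close>-subsets of \<open>S\<close>, whose
  number is a binomial coefficient bounded by the \<open>k\<close>-th power of
  \<open>card S\<close>.\<close>

lemma card_min_volume_simplices_le:
  fixes S :: "(real ^ 'd::finite) set"
  assumes S: "finite S"
  shows "card (min_volume_simplices TYPE('k::finite) S)
    \<le> 5 ^ CARD('k) * (4 * CARD('d) + 1) ^ CARD('d) * card S ^ CARD('k)"
proof -
  let ?C = "5 ^ CARD('k) * (4 * CARD('d) + 1) ^ CARD('d)"
  let ?\<F> = "{F. F \<subseteq> S \<and> card F = CARD('k)}"
  have fin: "finite ?\<F>"
    using S by simp
  have finP: "finite (low_apexes TYPE('k) S F)" for F
    by (rule finite_subset[OF _ S]) (auto simp: low_apexes_def min_volume_simplices_def spanned_simplices_def)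
  have "card (min_volume_simplices TYPE('k) S)
      \<le> card (\<Union>F\<in>?\<F>. (\<lambda>p. insert p F) ` low_apexes TYPE('k) S F)"
    using fin finP by (intro card_mono min_volume_subset_low_apexes) auto
  also have "\<dots> \<le> (\<Sum>F\<in>?\<F>. card ((\<lambda>p. insert p F) ` low_apexes TYPE('k) S F))"
    by (rule card_UN_le[OF fin])
  also have "\<dots> \<le> (\<Sum>F\<in>?\<F>. ?C)"
  proof (rule sum_mono)
    fix F assume "F \<in> ?\<F>"
    then have "card (low_apexes TYPE('k) S F) \<le> ?C"
      by (intro card_low_apexes[OF S]) simp
    then show "card ((\<lambda>p. insert p F) ` low_apexes TYPE('k) S F) \<le> ?C"
      using card_image_le[OF finP] by (rule order_trans[rotated])
  qed
  also have "\<dots> = (card S choose CARD('k)) * ?C"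
    using n_subsets[OF S] by simp
  also have "\<dots> \<le> card S ^ CARD('k) * ?C"
  proof (cases "CARD('k) \<le> card S")
    case True
    then show ?thesis by (intro mult_right_mono binomial_le_pow) auto
  qed (simp add: binomial_eq_0)
  finally show ?thesis
    by (simp add: mult.commute)
qed

subsection \<open>The lower bound\<close>

lemma gram_Ints:
  assumes "\<And>i j. u i \<bullet> u j \<in> \<int>"
  shows "gram u \<in> \<int>"
  using assms unfolding gram_def det_def
  by (intro Ints_sum Ints_mult Ints_prod) auto

lemma inner_Ints:
  fixes x y :: "real ^ 'd::finite"
  assumes "\<And>i. x $ i \<in> \<int>" "\<And>i. y $ i \<in> \<int>"
  shows "x \<bullet> y \<in> \<int>"
  unfolding inner_vec_def using assms by (intro Ints_sum) auto

lemma simplex_volume_lattice_ge: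
  fixes S :: "(real ^ 'd::finite) set"
  assumes S: "\<And>x i. x \<in> S \<Longrightarrow> x $ i \<in> \<int>" and T: "T \<in> spanned_simplices TYPE('k::finite) S"
  shows "1 / fact CARD('k) \<le> simplex_volume TYPE('k) T"
proof -
  have TS: "T \<subseteq> S" "card T = CARD('k) + 1"
    using T by (auto simp: spanned_simplices_def)
  then obtain a where a: "a \<in> T"
    by fastforce
  obtain p :: "'k idx \<Rightarrow> real ^ 'd" where p: "T = insert a (range p)" "gram (\<lambda>i. p i - a) \<noteq> 0"
    using spanned_simplexE[OF T a] by metis
  have "gram (\<lambda>i. p i - a) \<in> \<int>"
    using TS p(1) by (intro gram_Ints inner_Ints) (auto intro!: S Ints_diff)
  then have "1 \<le> gram (\<lambda>i. p i - a)"
    using simplex_volume_eq_gram(1)[OF p(2)] Ints_nonzero_abs_ge1 by fastforce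
  then show ?thesis
    unfolding p(1) simplex_volume_eq_gram(2)[OF p(2)] by (intro divide_right_mono) auto
qed

text \<open>The vectors are changed one at a time; \<open>u c\<close> stays in the family
  throughout, so each change is a shift within the span of the others.\<close>

lemma gram_shear:
  fixes u :: "'n::finite \<Rightarrow> 'a::real_inner"
  assumes "finite A" "c \<notin> A"
  shows "gram (\<lambda>i. if i \<in> A then u i + t i *\<^sub>R u c else u i) = gram u"
  using assms
proof (induction A rule: finite_induct)
  case (insert j A)
  let ?v = "\<lambda>i. if i \<in> A then u i + t i *\<^sub>R u c else u i"
  have "(\<lambda>i. if i \<in> insert j A then u i + t i *\<^sub>R u c else u i) = ?v(j := u j + t j *\<^sub>R u c)"
    by auto
  moreover have "gram (?v(j := u j + t j *\<^sub>R u c)) = gram ?v"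
  proof (rule gram_shift)
    have "u c \<in> ?v ` (- {j})"
      using insert by (intro image_eqI[of _ _ c]) auto
    then show "u j + t j *\<^sub>R u c - ?v j \<in> span (?v ` (- {j}))"
      using insert by (auto intro: span_scale span_base)
  qed
  ultimately show ?case
    using insert by simp
qed simp

text \<open>All lines run in direction \<open>e c\<close>; line \<open>c\<close> passes through 0
  and each other line \<open>i\<close> through \<open>e i\<close>. Each line carries
  \<open>m\<close> points, and further points of line \<open>c\<close> bring the total to
  \<open>n\<close>. A choice function \<open>g\<close> of positions on the lines determines one
  minimum simplex.\<close>

lemma exists_many_min_volume_simplices:
  fixes m n :: nat
  assumes kd: "CARD('k::finite) \<le> CARD('d::finite)" and mn: "CARD('k) * m \<le> n"
  shows "\<exists>S :: (real ^ 'd) set. finite S \<and> card S = n \<and>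
    (m - 1) ^ CARD('k) \<le> card (min_volume_simplices TYPE('k) S)"
proof -
  obtain \<iota> :: "'k idx \<Rightarrow> 'd" where \<iota>: "inj \<iota>"
    using card_le_inj[of "UNIV :: 'k idx set" "UNIV :: 'd set"] kd by (auto simp: card_idx)
  fix c :: "'k idx"
  define e :: "'k idx \<Rightarrow> real ^ 'd" where "e i = axis (\<iota> i) 1" for i
  define P where "P i j = (if i = c then 0 else e i) + real j *\<^sub>R e c" for i j
  have Pc: "P i j $ \<iota> c = real j" for i j
    using \<iota> by (auto simp: P_def e_def axis_def inj_eq)
  have P_eq: "P i j = P i' j' \<longleftrightarrow> i = i' \<and> j = j'" for i i' j j'
  proof
    assume eq: "P i j = P i' j'"
    have j: "j = j'"
      using arg_cong[OF eq, of "\<lambda>x. x $ \<iota> c"] by (simp add: Pc)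
    moreover have "i = i'"
      using eq \<iota> unfolding j P_def e_def by (auto simp: axis_eq_axis inj_eq split: if_splits)
    ultimately show "i = i' \<and> j = j'" by simp
  qed simp
  have P_int: "P i j $ l \<in> \<int>" for i j l
    by (auto simp: P_def e_def axis_def)
  define S0 where "S0 = (\<lambda>(i, j). P i j) ` (UNIV \<times> {..<m})"
  have "card S0 = CARD('k) * m"
    unfolding S0_def by (subst card_image) (auto simp: inj_on_def P_eq card_cartesian_product card_idx)
  moreover have "finite S0"
    by (simp add: S0_def)
  moreover have "n \<le> card (S0 \<union> P c ` {..<n})"
  proof -
    have "n = card (P c ` {..<n})"
      by (subst card_image) (auto simp: inj_on_def P_eq)
    also have "\<dots> \<le> card (S0 \<union> P c ` {..<n})"
      using \<open>finite S0\<close> by (intro card_mono) auto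
    finally show ?thesis .
  qed
  ultimately obtain S where S: "S0 \<subseteq> S" "S \<subseteq> S0 \<union> P c ` {..<n}" "card S = n"
    using exists_subset_between[of S0 n "S0 \<union> P c ` {..<n}"] mn by auto
  have fS: "finite S"
    using S \<open>finite S0\<close> by (meson finite_UnI finite_imageI finite_lessThan finite_subset)
  have S_int: "x $ i \<in> \<int>" if "x \<in> S" for x i
    using that S(2) P_int by (auto simp: S0_def)
  \<comment> \<open>On line \<open>c\<close> the simplex uses positions \<open>g c\<close> and
    \<open>Suc (g c)\<close>, the former as base point; elsewhere it uses
    \<open>g i\<close>.\<close>
  define p where "p g i = P i (if i = c then Suc (g i) else g i)" for g :: "'k idx \<Rightarrow> nat" and i
  define T where "T g = insert (P c (g c)) (range (p g))" for g
  have gram_p: "gram (\<lambda>i. p g i - P c (g c)) = 1" for g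
  proof -
    \<comment> \<open>The edge at index \<open>c\<close> is \<open>e c\<close> itself, and the
      others are \<open>e i\<close> sheared along it, so the family reduces to the orthonormal
      \<open>e\<close>.\<close>
    have "(\<lambda>i. p g i - P c (g c))
        = (\<lambda>i. if i \<in> - {c} then e i + (real (g i) - real (g c)) *\<^sub>R e c else e i)"
      by (auto simp: fun_eq_iff p_def P_def algebra_simps)
    then have "gram (\<lambda>i. p g i - P c (g c)) = gram e"
      using gram_shear[of "- {c}" c e "\<lambda>i. real (g i) - real (g c)"] by simp
    also have "(\<chi> i j. e i \<bullet> e j) = mat 1"
      using \<iota> by (auto simp: vec_eq_iff mat_def e_def inner_axis_axis inj_eq)
    then have "gram e = 1"
      unfolding gram_def by simp
    finally show ?thesis .
  qed
  have spanned: "T g \<in> spanned_simplices TYPE('k) S" if "T g \<subseteq> S" for g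
  proof -
    have "inj (p g)" "P c (g c) \<notin> range (p g)" "\<not> affine_dependent (T g)"
      using gram_p[of g] affine_independent_iff_gram[of "p g" "P c (g c)"] by (auto simp: T_def)
    then show ?thesis
      using that by (simp add: spanned_simplices_def T_def card_image card_idx)
  qed
  have vol: "simplex_volume TYPE('k) (T g) = 1 / fact CARD('k)" for g
    unfolding T_def by (subst simplex_volume_eq_gram(2)) (simp_all add: gram_p)
  have min: "T g \<in> min_volume_simplices TYPE('k) S" if "T g \<subseteq> S" for g
  proof -
    have "Min (simplex_volume TYPE('k) ` spanned_simplices TYPE('k) S) = 1 / fact CARD('k)"
    proof (rule Min_eqI)
      show "finite (simplex_volume TYPE('k) ` spanned_simplices TYPE('k) S)"
        using finite_spanned_simplices[OF fS] by (rule finite_imageI)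
      show "1 / fact CARD('k) \<in> simplex_volume TYPE('k) ` spanned_simplices TYPE('k) S"
        using spanned[OF that] vol by (metis imageI)
    qed (auto intro: simplex_volume_lattice_ge S_int)
    then show ?thesis
      using spanned[OF that] vol by (simp add: min_volume_simplices_def)
  qed
  have P_T: "P i j \<in> T g \<longleftrightarrow> j = g i \<or> i = c \<and> j = Suc (g i)" for i j g
    by (auto simp: T_def p_def P_eq image_iff)
  \<comment> \<open>Positions stop below \<open>m - 1\<close> so that the successor on line
    \<open>c\<close> still lies in \<open>S0\<close>.\<close>
  let ?G = "(UNIV :: 'k idx set) \<rightarrow>\<^sub>E {..<m - 1}"
  have "inj_on T ?G"
  proof (rule inj_onI)
    fix g g' assume eq: "T g = T g'"
    show "g = g'"
    proof
      fix i
      \<comment> \<open>On line \<open>c\<close> one membership alone allows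
        \<open>g c = Suc (g' c)\<close>; both together exclude an offset in either
        direction.\<close>
      have "P i (g i) \<in> T g'" "P i (g' i) \<in> T g"
        using P_T eq by blast+
      then show "g i = g' i"
        unfolding P_T by auto
    qed
  qed
  moreover have "T ` ?G \<subseteq> min_volume_simplices TYPE('k) S"
  proof (rule image_subsetI)
    fix g assume g: "g \<in> ?G"
    have "g i < m - 1" for i
      using g by auto
    then have "g i < m" "Suc (g i) < m" for i
      by (metis less_diff_conv add.commute plus_1_eq_Suc Suc_lessD)+
    then have "T g \<subseteq> S0"
      by (auto simp: T_def S0_def p_def)
    then show "T g \<in> min_volume_simplices TYPE('k) S"
      using S by (intro min) auto
  qed
  moreover have "finite (min_volume_simplices TYPE('k) S)"
    using finite_spanned_simplices[OF fS] by (rule rev_finite_subset) (auto simp: min_volume_simplices_def)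
  ultimately have "card ?G \<le> card (min_volume_simplices TYPE('k) S)"
    by (rule card_inj_on_le)
  then have "(m - 1) ^ CARD('k) \<le> card (min_volume_simplices TYPE('k) S)"
    by (simp add: card_PiE card_idx)
  then show ?thesis
    using fS S by blast
qed

theorem theorem4:
  assumes "CARD('k::finite) \<le> CARD('d::finite)"
  shows "(\<exists>C>0. \<forall>S :: (real ^ 'd) set. finite S \<longrightarrow>
            real (card (min_volume_simplices TYPE('k) S)) \<le> C * real (card S) ^ CARD('k))
       \<and> (\<exists>c>0. \<forall>\<^sub>F n in sequentially. \<exists>S :: (real ^ 'd) set. finite S \<and> card S = n \<and>
            c * real n ^ CARD('k) \<le> real (card (min_volume_simplices TYPE('k) S)))"
proof
  let ?k = "CARD('k)"
  let ?C = "5 ^ ?k * (4 * CARD('d) + 1) ^ CARD('d)"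
  show "\<exists>C>0. \<forall>S :: (real ^ 'd) set. finite S \<longrightarrow>
      real (card (min_volume_simplices TYPE('k) S)) \<le> C * real (card S) ^ ?k"
  proof (intro exI[of _ "real ?C"] conjI allI impI)
    fix S :: "(real ^ 'd) set" assume "finite S"
    from card_min_volume_simplices_le[OF this, where 'k = 'k]
    have "real (card (min_volume_simplices TYPE('k) S)) \<le> real (?C * card S ^ ?k)"
      by (rule of_nat_mono)
    then show "real (card (min_volume_simplices TYPE('k) S)) \<le> real ?C * real (card S) ^ ?k"
      by simp
  qed simp
  show "\<exists>c>0. \<forall>\<^sub>F n in sequentially. \<exists>S :: (real ^ 'd) set. finite S \<and> card S = n \<and>
      c * real n ^ ?k \<le> real (card (min_volume_simplices TYPE('k) S))"
  \<comment> \<open>With m = n div k, m - 1 exceeds n / k - 2, and this is at least n / (2k) as soon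
    as n \<ge> 4k.\<close>
  proof (intro exI[of _ "(1 / (2 * real ?k)) ^ ?k"] conjI eventually_sequentiallyI[of "4 * ?k"])
    fix n assume n: "4 * ?k \<le> n"
    define m where "m = n div ?k"
    have "?k * m \<le> n"
      by (simp add: m_def)
    then obtain S :: "(real ^ 'd) set" where S: "finite S" "card S = n"
      "(m - 1) ^ ?k \<le> card (min_volume_simplices TYPE('k) S)"
      using exists_many_min_volume_simplices[OF assms] by blast
    have "n < ?k * (m + 1)"
      by (simp add: m_def dividend_less_times_div)
    then have "real n < real ?k * (real m + 1)"
      by (metis of_nat_1 of_nat_add of_nat_less_iff of_nat_mult)
    moreover have "4 * real ?k \<le> real n"
      using n by (metis of_nat_le_iff of_nat_mult of_nat_numeral)
    ultimately have "real n \<le> (real m - 1) * (2 * real ?k)"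
      by (simp add: algebra_simps)
    then have "1 / (2 * real ?k) * real n \<le> real m - 1"
      by (simp add: divide_le_eq)
    also have "\<dots> \<le> real (m - 1)"
      by simp
    finally have "(1 / (2 * real ?k) * real n) ^ ?k \<le> real (m - 1) ^ ?k"
      by (rule power_mono) simp
    also have "\<dots> \<le> real (card (min_volume_simplices TYPE('k) S))"
      using S(3) by (metis of_nat_le_iff of_nat_power)
    finally show "\<exists>S :: (real ^ 'd) set. finite S \<and> card S = n \<and>
        (1 / (2 * real ?k)) ^ ?k * real n ^ ?k \<le> real (card (min_volume_simplices TYPE('k) S))"
      unfolding power_mult_distrib using S(1,2) by blast
  qed simp
qed

end
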